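(* For every positive integer $n>2$ there is a prime number $p$ with $4n<p<5n$. *)

theory Defs
  imports "HOL-Computational_Algebra.Primes"
begin

end

theory Submission
  imports Defs "HOL-Analysis.Complex_Transcendental" "HOL-Analysis.Harmonic_Numbers"
    "HOL-Number_Theory.Prime_Powers"
begin

text \<open>
  Chebyshev's method: with \<open>\<psi>(x) = \<Sum>\<^sub>d\<^sub>\<le>\<^sub>x \<Lambda>(d)\<close> and \<open>T(x) = ln \<lfloor>x\<rfloor>!\<close>, the combination
  \<open>S(x) = T(x) - T(x/2) - T(x/3) - T(x/5) + T(x/30)\<close> satisfies \<open>\<psi>(x) - \<psi>(x/6) \<le> S(x) \<le> \<psi>(x)\<close>,
  and Stirling's formula gives \<open>S(x) = A x + O(ln x)\<close>. Hence \<open>\<psi>\<close> lies between \<open>A x\<close> and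
  \<open>6/5 A x\<close> up to \<open>O(ln\<^sup>2 x)\<close>. As \<open>6/5 < 5/4\<close>, the difference \<open>\<psi>(5n) - \<psi>(4n)\<close> grows at least
  like \<open>A n / 5\<close>, whereas proper prime powers contribute only \<open>O(sqrt n ln n)\<close> to it. This settles
  \<open>n \<ge> 10000\<close>; an explicit chain of primes covers the smaller \<open>n\<close>.
\<close>

section \<open>The Chebyshev function and factorials\<close>

definition psi :: "nat \<Rightarrow> real" where
  "psi N = (\<Sum>d=1..N. mangoldt d)"

text \<open>From \<open>N\<close> to \<open>N + 1\<close> the quotient \<open>N div d\<close> grows
  by one exactly if \<open>d\<close> divides \<open>N + 1\<close>. The free upper limit
  \<open>M\<close> lets factorials of different sizes share one range of summation.\<close>

lemma ln_fact_conv_mangoldt: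
  assumes "N \<le> M"
  shows "ln (fact N) = (\<Sum>d=1..M. mangoldt d * real (N div d))"
  using assms
proof (induction N)
  case 0
  then show ?case by simp
next
  case (Suc N)
  have "ln (fact (Suc N) :: real) = ln (real (Suc N)) + ln (fact N)"
    by (simp add: ln_mult del: of_nat_Suc)
  also have "ln (real (Suc N)) = (\<Sum>d | d dvd Suc N. mangoldt d)"
    by (simp add: mangoldt_sum del: of_nat_Suc)
  also have "\<dots> = (\<Sum>d=1..M. if d dvd Suc N then mangoldt d else 0)"
  proof (rule sum.mono_neutral_cong_left)
    show "{d. d dvd Suc N} \<subseteq> {1..M}"
    proof
      fix d assume "d \<in> {d. d dvd Suc N}"
      then have "d \<le> Suc N" "d > 0" by (auto intro!: dvd_imp_le Nat.gr0I)
      then show "d \<in> {1..M}" using Suc.prems by simp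
    qed
  qed auto
  also have "\<dots> + ln (fact N) = 
      (\<Sum>d=1..M. (if d dvd Suc N then mangoldt d else 0) + mangoldt d * real (N div d))"
    using Suc by (simp add: sum.distrib)
  also have "\<dots> = (\<Sum>d=1..M. mangoldt d * real (Suc N div d))"
    by (intro sum.cong) (auto simp: div_Suc dvd_eq_mod_eq_0 algebra_simps)
  finally show ?case .
qed

section \<open>Stirling-type bounds\<close>

lemma ln_fact_ge:
  assumes "m > 0"
  shows "real m * ln m - m + 1 \<le> ln (fact m)"
  using assms
proof (induction m rule: nat_induct_non_zero)
  case (Suc m)
  have "ln (real (Suc m)) - ln m \<le> 1 / m"
    using ln_diff_le[of "real (Suc m)" "real m"] Suc by simp
  then have "real m * (ln (real (Suc m)) - ln m) \<le> 1"
    using Suc by (simp add: field_simps)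
  moreover have "ln (fact (Suc m) :: real) = ln (real (Suc m)) + ln (fact m)"
    by (simp add: ln_mult del: of_nat_Suc)
  ultimately show ?case using Suc by (simp add: algebra_simps)
qed simp

lemma ln_fact_le:
  assumes "m > 0"
  shows "ln (fact m) \<le> real m * ln m - m + 1 + ln m"
  using assms
proof (induction m rule: nat_induct_non_zero)
  case (Suc m)
  have "ln m - ln (real (Suc m)) \<le> - 1 / Suc m"
    using ln_diff_le[of "real m" "real (Suc m)"] Suc by simp
  then have "real (Suc m) * (ln (real (Suc m)) - ln m) \<ge> 1"
    using Suc by (simp add: field_simps)
  moreover have "ln (fact (Suc m) :: real) = ln (real (Suc m)) + ln (fact m)"
    by (simp add: ln_mult del: of_nat_Suc)
  ultimately show ?case using Suc by (simp add: algebra_simps)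
qed simp

text \<open>Between \<open>m = N div k\<close> and \<open>x\<close>, at distance at most 1, the
  function \<open>t * ln t - t\<close> has derivative at most \<open>ln x\<close>, so rounding
  \<open>x\<close> down costs at most \<open>ln x\<close>.\<close>

lemma ln_fact_div_bounds:
  assumes "k > 0" "k \<le> N"
  defines "x \<equiv> real N / real k"
  shows "x * ln x - x + 1 - ln x \<le> ln (fact (N div k))"
    and "ln (fact (N div k)) \<le> x * ln x - x + 1 + ln x"
proof -
  define m where "m = N div k"
  have m: "m \<ge> 1" using assms by (simp add: m_def div_greater_zero_iff Suc_leI)
  have mx: "real m \<le> x" unfolding m_def x_def by (rule of_nat_div_le_of_nat)
  have "real (N div k) = of_int \<lfloor>x\<rfloor>" unfolding x_def by (simp add: floor_divide_of_nat_eq)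
  then have xm: "x \<le> m + 1" unfolding m_def by linarith
  have x: "x \<ge> 1" using m mx by linarith
  have "real m * (ln x - ln m) \<le> x - m"
    using ln_diff_le[of x "real m"] m x by (simp add: field_simps)
  moreover have "(x - m) * ln x \<le> 1 * ln x"
    using xm x by (intro mult_right_mono) auto
  ultimately show "x * ln x - x + 1 - ln x \<le> ln (fact (N div k))"
    using ln_fact_ge[of m] m by (simp add: algebra_simps m_def)
  have "x * (ln m - ln x) \<le> m - x"
    using ln_diff_le[of "real m" x] m x by (simp add: field_simps)
  moreover have "0 \<le> (x - m) * ln m"
    using mx m by (intro mult_nonneg_nonneg) auto
  moreover have "ln m \<le> ln x" using m x mx by simp
  ultimately show "ln (fact (N div k)) \<le> x * ln x - x + 1 + ln x"
    using ln_fact_le[of m] m by (simp add: algebra_simps m_def)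
qed

section \<open>Chebyshev's combination of factorials\<close>

definition cheb_sum :: "nat \<Rightarrow> real" where
  "cheb_sum N = ln (fact N) - ln (fact (N div 2)) - ln (fact (N div 3)) - ln (fact (N div 5))
     + ln (fact (N div 30))"

text \<open>The weight of \<open>mangoldt d\<close> in \<open>cheb_sum N\<close>, where
  \<open>k = N div d\<close>.\<close>

definition cheb_coeff :: "nat \<Rightarrow> real" where
  "cheb_coeff k = real k - real (k div 2) - real (k div 3) - real (k div 5) + real (k div 30)"

text \<open>The constant \<open>A\<close>, that is
  \<open>ln (2^(1/2) * 3^(1/3) * 5^(1/5) / 30^(1/30))\<close>, about 0.921.\<close>

definition cheb_const :: real where
  "cheb_const = (14 * ln 2 + 9 * ln 3 + 5 * ln 5) / 30"

text \<open>Since \<open>1 - 1/2 - 1/3 - 1/5 + 1/30 = 0\<close>, the coefficient has period 30 and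
  the residues can be checked one by one.\<close>

lemma cheb_coeff_bounds:
  "0 \<le> cheb_coeff k" "cheb_coeff k \<le> 1" "0 < k \<Longrightarrow> k < 6 \<Longrightarrow> cheb_coeff k = 1"
proof -
  define q r where "q = k div 30" and "r = k mod 30"
  have k: "k = 30 * q + r" by (simp add: q_def r_def)
  have "k div 2 = 15 * q + r div 2" "k div 3 = 10 * q + r div 3" "k div 5 = 6 * q + r div 5"
    unfolding k by linarith+
  then have c: "cheb_coeff k = real r - real (r div 2) - real (r div 3) - real (r div 5)"
    unfolding cheb_coeff_def q_def[symmetric] by (simp add: k)
  have "r \<in> set [0..<30]" by (simp add: r_def)
  then have "0 \<le> cheb_coeff k \<and> cheb_coeff k \<le> 1"
    unfolding c by (auto simp: upt_rec)
  then show "0 \<le> cheb_coeff k" "cheb_coeff k \<le> 1" by auto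
  assume "0 < k" "k < 6"
  then have "k \<in> {1, 2, 3, 4, 5}" by auto
  then show "cheb_coeff k = 1" by (auto simp: cheb_coeff_def)
qed

lemma cheb_sum_eq: "cheb_sum N = (\<Sum>d=1..N. mangoldt d * cheb_coeff (N div d))"
proof -
  have [simp]: "N div a div d = N div d div a" for a d
    by (metis div_mult2_eq mult.commute)
  show ?thesis
    unfolding cheb_sum_def cheb_coeff_def
    by (simp add: ln_fact_conv_mangoldt[of _ N] sum_subtractf sum.distrib ring_distribs)
qed

lemma cheb_sum_le_psi: "cheb_sum N \<le> psi N"
  unfolding cheb_sum_eq psi_def
  by (intro sum_mono mult_left_le cheb_coeff_bounds(2) mangoldt_nonneg)

text \<open>For \<open>N div 6 < d \<le> N\<close> the coefficient is 1, and the other terms of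
  \<open>cheb_sum N\<close> are nonnegative.\<close>

lemma psi_le_cheb_sum: "psi N \<le> psi (N div 6) + cheb_sum N"
proof -
  have "psi N = (\<Sum>d\<in>{1..N div 6} \<union> {N div 6 + 1..N}. mangoldt d)"
    unfolding psi_def by (rule sum.cong) auto
  also have "\<dots> = psi (N div 6) + (\<Sum>d\<in>{N div 6 + 1..N}. mangoldt d)"
    unfolding psi_def by (subst sum.union_disjoint) auto
  also have "(\<Sum>d\<in>{N div 6 + 1..N}. mangoldt d :: real) 
      = (\<Sum>d\<in>{N div 6 + 1..N}. mangoldt d * cheb_coeff (N div d))"
  proof (rule sum.cong)
    fix d assume d: "d \<in> {N div 6 + 1..N}"
    then have "N < d * 6" by simp linarith
    with d have "0 < N div d" "N div d < 6" by (auto simp: div_greater_zero_iff less_mult_imp_div_less mult.commute)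
    then show "(mangoldt d :: real) = mangoldt d * cheb_coeff (N div d)"
      by (simp add: cheb_coeff_bounds)
  qed simp
  also have "\<dots> \<le> cheb_sum N"
    unfolding cheb_sum_eq
    by (intro sum_mono2) (auto intro!: mult_nonneg_nonneg mangoldt_nonneg cheb_coeff_bounds)
  finally show ?thesis by simp
qed

section \<open>Numerical constants and the growth of \<open>cheb_sum\<close>\<close>

text \<open>Serves \<open>ln 30 \<ge> 5/2\<close> and \<open>ln 6 \<ge> 5/3\<close>, as 149 is below
  \<open>30^2\<close> and \<open>6^3\<close>.\<close>

lemma exp_5_le: "exp 5 \<le> (149 :: real)"
proof -
  have "exp (real 5) = exp 1 ^ 5" by (subst exp_of_nat_mult [symmetric]) simp
  also have "\<dots> \<le> (272 / 100) ^ 5" using e_less_272 by (intro power_mono) auto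
  finally show ?thesis by (simp add: power_divide)
qed

text \<open>\<open>30 * cheb_const\<close> is the logarithm of \<open>2^14 * 3^9 * 5^5\<close>,
  which exceeds \<open>e^27\<close>.\<close>

lemma cheb_const_ge: "cheb_const \<ge> 9 / 10"
proof -
  have "exp (real 27) = exp 1 ^ 27" by (subst exp_of_nat_mult [symmetric]) simp
  also have "\<dots> \<le> (272 / 100) ^ 27" using e_less_272 by (intro power_mono) auto
  also have "\<dots> \<le> (2 ^ 14 * 3 ^ 9 * 5 ^ 5 :: real)" by (simp add: power_divide)
  finally have "27 \<le> ln (2 ^ 14 * 3 ^ 9 * 5 ^ 5 :: real)"
    by (subst ln_ge_iff) auto
  also have "\<dots> = 14 * ln 2 + 9 * ln 3 + 5 * ln 5"
    by (simp only: ln_mult ln_realpow) (simp add: ln_mult ln_realpow)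
  finally show ?thesis by (simp add: cheb_const_def)
qed

text \<open>The terms \<open>x * ln x\<close> and \<open>x\<close> cancel because
  \<open>1 - 1/2 - 1/3 - 1/5 + 1/30 = 0\<close>; the logarithms of 2, 3, 5 and 30 leave the main
  term.\<close>

lemma cheb_sum_bounds:
  assumes "N \<ge> 30"
  shows "cheb_const * N - 5 * ln N \<le> cheb_sum N"
    and "cheb_sum N \<le> cheb_const * N + 5 * ln N - 6"
proof -
  let ?x = "real N" and ?L = "ln (real N)"
  have [simp]: "ln (real N / k) = ?L - ln k" if "k > 0" for k
    using assms that by (simp add: ln_div)
  have ln30: "ln 30 = ln 2 + ln 3 + ln (5::real)"
    using ln_mult[of 6 "5::real"] ln_mult[of 2 "3::real"] by simp
  \<comment> \<open>The remainders in the upper bound add up to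
    \<open>5 * ln N - 2 * ln 30 - 1\<close>; \<open>ln 30 \<ge> 5/2\<close> makes this at most
    \<open>5 * ln N - 6\<close>.\<close>
  have "5 \<le> ln (900::real)" using exp_5_le by (subst ln_ge_iff) auto
  also have "ln (900::real) = 2 * ln 30" using ln_mult[of 30 "30::real"] by simp
  finally have l: "ln 30 \<ge> (5/2 :: real)" by simp
  note b1 = ln_fact_div_bounds[of 1 N]
  note b2 = ln_fact_div_bounds[of 2 N]
  note b3 = ln_fact_div_bounds[of 3 N]
  note b5 = ln_fact_div_bounds[of 5 N]
  note b30 = ln_fact_div_bounds[of 30 N]
  have eq: "(?x * ?L - ?x) - (?x/2 * (?L - ln 2) - ?x/2) - (?x/3 * (?L - ln 3) - ?x/3)
     - (?x/5 * (?L - ln 5) - ?x/5) + (?x/30 * (?L - ln 30) - ?x/30) = cheb_const * N"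
    unfolding ln30 cheb_const_def by (simp add: field_simps)
  show "cheb_const * N - 5 * ln N \<le> cheb_sum N"
    using b1(1) b2(2) b3(2) b5(2) b30(1) l assms ln30
    unfolding eq[symmetric] cheb_sum_def by simp
  show "cheb_sum N \<le> cheb_const * N + 5 * ln N - 6"
    using b1(2) b2(1) b3(1) b5(1) b30(2) l assms ln30
    unfolding eq[symmetric] cheb_sum_def by simp
qed

section \<open>Upper bound for \<open>psi\<close>\<close>

lemma psi_le_ln_fact: "psi N \<le> ln (fact N)"
  unfolding psi_def ln_fact_conv_mangoldt[OF order_refl]
proof (rule sum_mono)
  fix d assume "d \<in> {1..N}"
  then have "1 \<le> N div d" by (simp add: div_greater_zero_iff Suc_leI)
  then have "1 \<le> real (N div d)" by linarith
  then show "mangoldt d \<le> mangoldt d * real (N div d)"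
    using mult_left_mono[of 1 "real (N div d)" "mangoldt d"] mangoldt_nonneg[of d] by simp
qed

lemma ln_6_bounds: "5 / 3 \<le> ln (6::real)" "ln (6::real) \<le> 2"
proof -
  have "5 \<le> ln (216::real)" using exp_5_le by (subst ln_ge_iff) auto
  also have "ln (216::real) = 3 * ln 6" using ln_realpow[of 6 3] by simp
  finally show "5 / 3 \<le> ln (6::real)" by simp
  have "exp 1 \<ge> (5/2 :: real)" using exp_lower_Taylor_quadratic[of 1] by simp
  then have "exp 1 * exp 1 \<ge> (5/2 * (5/2) :: real)" by (intro mult_mono) auto
  then have "exp 2 \<ge> (6::real)" by (simp flip: exp_add)
  then show "ln (6::real) \<le> 2" using ln_le_cancel_iff[of 6 "exp (2::real)"] by simp
qed

text \<open>Iterating \<open>\<psi>(x) \<le> \<psi>(x/6) + S(x)\<close> sums the main terms geometrically to \<open>6/5 A x\<close>. In the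
  induction step, \<open>3/2 ln\<^sup>2\<close> absorbs \<open>5 ln x - 6\<close> because \<open>5/3 \<le> ln 6 \<le> 2\<close>.\<close>
lemma psi_upper:
  assumes "N > 0"
  shows "psi N \<le> 6 / 5 * cheb_const * N + 3 / 2 * (ln N)\<^sup>2 + 150"
  using assms
proof (induction N rule: less_induct)
  case (less N)
  show ?case
  proof (cases "N < 30")
    case True
    have "psi N \<le> ln (fact N)" by (rule psi_le_ln_fact)
    also have "\<dots> \<le> ln (real N ^ N)"
      using less.prems fact_le_power[of N, where 'a = real] by (subst ln_le_cancel_iff) auto
    also have "\<dots> = N * ln N" using less.prems by (simp add: ln_realpow)
    \<comment> \<open>The base case is what the constant 150 pays for:
      \<open>ln 32 = 5 * ln 2 < 5\<close>.\<close>
    also have "\<dots> \<le> 30 * ln 32" using True less.prems by (intro mult_mono) auto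
    also have "ln (32::real) = 5 * ln 2" using ln_realpow[of 2 5] by simp
    also have "30 * (5 * ln (2::real)) \<le> 150" using ln_2_less_1 by simp
    finally show ?thesis
      using cheb_const_ge mult_nonneg_nonneg[of "6 / 5 * cheb_const" N] zero_le_power2[of "ln N"]
      by linarith
  next
    case False
    define L where "L = ln (real N)"
    have N6: "N div 6 > 0" "real (N div 6) \<le> N / 6" using False by linarith+
    then have "ln (real (N div 6)) \<le> ln (real N / 6)"
      by (subst ln_le_cancel_iff) auto
    also have "\<dots> = L - ln 6" using False by (simp add: L_def ln_div)
    finally have "(ln (real (N div 6)))\<^sup>2 \<le> (L - ln 6)\<^sup>2"
      using N6 by (intro power_mono) auto
    moreover have "ln 6 * ln 6 \<le> 2 * (2 :: real)"
      using ln_6_bounds by (intro mult_mono) auto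
    moreover have "5 / 3 * L \<le> ln 6 * L"
      using False ln_6_bounds by (intro mult_right_mono) (auto simp: L_def)
    ultimately have sq: "3 / 2 * (ln (real (N div 6)))\<^sup>2 + 5 * L - 6 \<le> 3 / 2 * L\<^sup>2"
      by (simp add: power2_eq_square algebra_simps)
    have "6 / 5 * cheb_const * real (N div 6) \<le> 6 / 5 * cheb_const * (N / 6)"
      using cheb_const_ge N6 by (intro mult_left_mono) auto
    moreover have "psi N \<le> psi (N div 6) + cheb_sum N" by (rule psi_le_cheb_sum)
    moreover have "psi (N div 6) \<le> 6 / 5 * cheb_const * real (N div 6) + 3 / 2 * (ln (real (N div 6)))\<^sup>2 + 150"
      using less.IH[of "N div 6"] N6 False by simp
    ultimately show ?thesis
      using cheb_sum_bounds(2)[of N] False sq by (simp add: L_def algebra_simps)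
  qed
qed

section \<open>Contribution of proper prime powers\<close>

text \<open>As \<open>b \<le> 2 * a\<close>, each prime has at most one power between \<open>a\<close> and \<open>b\<close>, so the proper prime
  powers there inject into the primes up to \<open>sqrt b\<close>.\<close>
lemma psi_diff_le_no_primes:
  assumes "b \<le> 2 * a" and no_prime: "\<And>p. prime p \<Longrightarrow> a < p \<Longrightarrow> p \<le> b \<Longrightarrow> False"
    and "b > 0" "a \<le> b"
  shows "psi b - psi a \<le> sqrt b * ln (sqrt b)"
proof -
  define D where "D = {d\<in>{a+1..b}. primepow d}"
  define r where "r = nat \<lfloor>sqrt b\<rfloor>"
  have r: "real r \<le> sqrt b" "r \<ge> 1" using assms by (auto simp: r_def le_nat_iff)
  have ex: "\<exists>p k. prime p \<and> k > 1 \<and> d = p ^ k" if "d \<in> D" for d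
  proof -
    from that obtain p k where pk: "prime p" "k > 0" "d = p ^ k"
      by (auto simp: D_def primepow_def)
    with that no_prime[of p] have "k \<noteq> 1" by (auto simp: D_def)
    with pk have "k > 1" by simp
    with pk show ?thesis by blast
  qed
  have inj: "inj_on aprimedivisor D"
  proof (rule inj_onI)
    have *: "\<not> k < l" if "p ^ k \<in> D" "p ^ l \<in> D" "prime p" for p k l
    proof
      assume "k < l"
      have "2 * a < 2 * p ^ k" using that by (auto simp: D_def)
      also have "\<dots> \<le> p * p ^ k" using prime_ge_2_nat[OF that(3)] by simp
      also have "\<dots> \<le> p ^ l"
        using \<open>k < l\<close> prime_gt_0_nat[OF that(3)] power_increasing[of "Suc k" l p] by simp
      also have "\<dots> \<le> b" using that by (auto simp: D_def)
      finally show False using assms by simp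
    qed
    fix d e assume de: "d \<in> D" "e \<in> D" "aprimedivisor d = aprimedivisor e"
    obtain p k where d: "prime p" "k > 1" "d = p ^ k" using ex[OF de(1)] by blast
    obtain q l where e: "prime q" "l > 1" "e = q ^ l" using ex[OF de(2)] by blast
    have "p = q" using d e de(3) by (simp add: aprimedivisor_prime_power)
    moreover have "k = l"
      using *[of p k l] *[of p l k] d e de \<open>p = q\<close> by fastforce
    ultimately show "d = e" using d e by simp
  qed
  have sub: "aprimedivisor ` D \<subseteq> {1..r}"
  proof (safe)
    fix d assume "d \<in> D"
    then obtain p k where d: "prime p" "k > 1" "d = p ^ k" using ex by blast
    have "p ^ 2 \<le> p ^ k" using d prime_gt_0_nat[OF d(1)] by (intro power_increasing) auto
    also have "\<dots> \<le> b" using \<open>d \<in> D\<close> d by (simp add: D_def)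
    finally have "real p ^ 2 \<le> b" by (metis of_nat_le_iff of_nat_power)
    then have "p \<le> sqrt b" by (rule real_le_rsqrt)
    then have "p \<le> r" unfolding r_def by (simp add: le_nat_floor)
    then show "aprimedivisor d \<in> {1..r}"
      using d prime_gt_0_nat[OF d(1)] by (simp add: aprimedivisor_prime_power)
  qed
  have "psi b = (\<Sum>d\<in>{1..a} \<union> {a + 1..b}. mangoldt d)"
    unfolding psi_def using assms by (intro sum.cong) auto
  also have "\<dots> = psi a + (\<Sum>d\<in>{a + 1..b}. mangoldt d)"
    unfolding psi_def by (subst sum.union_disjoint) auto
  finally have "psi b - psi a = (\<Sum>d\<in>{a + 1..b}. mangoldt d)" by simp
  also have "\<dots> = (\<Sum>d\<in>D. ln (real (aprimedivisor d)))"
    unfolding D_def by (intro sum.mono_neutral_cong_right) (auto simp: mangoldt_def)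
  also have "\<dots> = (\<Sum>p\<in>aprimedivisor ` D. ln (real p))"
    using inj by (simp add: sum.reindex)
  \<comment> \<open>Summing over all integers up to \<open>r\<close>, not just primes, still leaves
    order \<open>sqrt b * ln b\<close>.\<close>
  also have "\<dots> \<le> (\<Sum>p\<in>{1..r}. ln (real p))"
    using sub by (intro sum_mono2) auto
  also have "\<dots> \<le> (\<Sum>p\<in>{1..r}. ln (real r))"
    by (intro sum_mono) auto
  also have "\<dots> = r * ln (real r)" by simp
  also have "\<dots> \<le> sqrt b * ln (sqrt b)"
    using r by (intro mult_mono ln_mono) auto
  finally show ?thesis .
qed

section \<open>The range \<open>n \<ge> 10000\<close>\<close>

text \<open>Here \<open>y\<close> stands for \<open>sqrt (5 * n)\<close>.\<close>
lemma error_terms_small: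
  fixes y :: real
  assumes "y \<ge> 223"
  shows "y * ln y + 10 * ln y + 6 * (ln y)\<^sup>2 + 150 < 9 / 250 * y\<^sup>2"
proof -
  \<comment> \<open>Tangent to \<open>ln\<close> at 256, a power of 2 near 223; its intercept is at
    most \<open>8 * 7/10 - 1 = 23/5\<close>.\<close>
  have "ln y - ln 256 \<le> (y - 256) / 256" using ln_diff_le[of y 256] assms by simp
  moreover have "ln (256::real) = 8 * ln 2" using ln_realpow[of 2 8] by simp
  moreover have "ln 2 \<le> (7/10::real)" using ln2_le_25_over_36 by simp
  ultimately have l: "ln y \<le> y / 256 + 23 / 5" by simp
  have "ln y \<ge> 0" using assms by simp
  define z where "z = y\<^sup>2"
  have "y * ln y \<le> y * (y / 256 + 23 / 5)" using l assms by (intro mult_left_mono) auto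
  also have "\<dots> = z / 256 + 23 / 5 * y" by (simp add: z_def power2_eq_square algebra_simps)
  finally have 1: "y * ln y \<le> z / 256 + 23 / 5 * y" .
  have "(ln y)\<^sup>2 \<le> (y / 256 + 23 / 5)\<^sup>2"
    using l \<open>ln y \<ge> 0\<close> by (intro power_mono) auto
  also have "\<dots> = z / 65536 + 23 / 640 * y + 529 / 25"
    by (simp add: z_def power2_eq_square algebra_simps)
  finally have 2: "(ln y)\<^sup>2 \<le> z / 65536 + 23 / 640 * y + 529 / 25" .
  have "z \<ge> 223 * y" using assms by (simp add: z_def power2_eq_square)
  with 1 2 l assms show ?thesis unfolding z_def[symmetric] by linarith
qed

lemma prime_between_4n_5n_large:
  assumes "n \<ge> 10000"
  shows "\<exists>p::nat. prime p \<and> 4 * n < p \<and> p < 5 * n"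
proof (rule ccontr)
  assume none: "\<not> ?thesis"
  define y where "y = sqrt (5 * n)"
  have y2: "y\<^sup>2 = 5 * n" by (simp add: y_def)
  \<comment> \<open>\<open>223\<^sup>2 = 49729\<close> lies just below
    \<open>5 * 10000\<close>.\<close>
  have "y \<ge> sqrt (223\<^sup>2)" unfolding y_def using assms by (intro real_sqrt_le_mono) auto
  then have y: "y \<ge> 223" by simp
  have lny: "ln (real (5 * n)) = 2 * ln y"
    unfolding y2[symmetric] using y by (simp add: ln_realpow)
  \<comment> \<open>The sum \<open>psi (5 * n)\<close> includes the endpoint \<open>5 * n\<close>,
    which the strict bound excludes.\<close>
  have "\<not> prime (5 * n)" using assms prime_product[of 5 n] by auto
  then have "psi (5 * n) - psi (4 * n) \<le> sqrt (5 * n) * ln (sqrt (5 * n))"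
  proof (intro psi_diff_le_no_primes)
    fix p assume "prime p" "4 * n < p" "p \<le> 5 * n"
    with \<open>\<not> prime (5 * n)\<close> have "p < 5 * n" by (metis le_neq_implies_less)
    with \<open>prime p\<close> \<open>4 * n < p\<close> none show False by blast
  qed (use assms in auto)
  also have "\<dots> = y * ln y" by (simp add: y_def)
  finally have "psi (5 * n) - psi (4 * n) \<le> y * ln y" .
  moreover have "cheb_const * (5 * n) - 10 * ln y \<le> psi (5 * n)"
    using cheb_sum_bounds(1)[of "5 * n"] cheb_sum_le_psi[of "5 * n"] assms lny by simp
  moreover have "(ln (real (4 * n)))\<^sup>2 \<le> (2 * ln y)\<^sup>2"
    unfolding lny[symmetric] using assms by (intro power_mono) auto
  then have "psi (4 * n) \<le> 6 / 5 * cheb_const * (4 * n) + 6 * (ln y)\<^sup>2 + 150"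
    using psi_upper[of "4 * n"] assms by simp
  moreover have "9 / 10 * real n \<le> cheb_const * n"
    using cheb_const_ge by (intro mult_right_mono) auto
  \<comment> \<open>The main terms differ by \<open>(5 - 24/5) * cheb_const * n\<close>, at least
    \<open>9/50 * n\<close>, which is \<open>9/250 * y\<^sup>2\<close>.\<close>
  ultimately have "9 / 50 * real n \<le> y * ln y + 10 * ln y + 6 * (ln y)\<^sup>2 + 150"
    by simp
  with error_terms_small[OF y] show False by (simp add: y2)
qed

section \<open>A chain of primes for small \<open>n\<close>\<close>

text \<open>\<open>(p + 3) div 4\<close> is the least \<open>n\<close> with
  \<open>p \<le> 4 * n\<close>, the first for which \<open>p\<close> fails; if the next entry is
  below \<open>5 * n\<close> there, it is so for all larger \<open>n\<close>. Hence the first entry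
  above \<open>4 * n\<close> will do.\<close>

lemma exists_in_chain_between_4n_5n:
  fixes n :: nat
  assumes "successively (\<lambda>p q. q < 5 * ((p + 3) div 4)) (p # ps)"
    and "p < 5 * n" "4 * n < last (p # ps)"
  shows "\<exists>q\<in>set (p # ps). 4 * n < q \<and> q < 5 * n"
  using assms
proof (induction ps arbitrary: p)
  case (Cons q ps)
  show ?case
  proof (cases "4 * n < p")
    case False
    then have "(p + 3) div 4 \<le> n" by linarith
    moreover have "q < 5 * ((p + 3) div 4)" using Cons.prems(1) by simp
    ultimately have "q < 5 * n" by linarith
    with Cons.IH[of q] Cons.prems show ?thesis by auto
  qed (use Cons.prems in auto)
qed auto

text \<open>Two cofactors of at least \<open>k\<close> would give \<open>k * k \<le> p\<close>.
  Allowing \<open>p = d\<close> lets one range of divisors serve also the primes below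
  \<open>k\<close>.\<close>

lemma prime_nat_trial_division:
  fixes p :: nat
  assumes "1 < p" "p < k * k" and no_dvd: "\<forall>d\<in>{2..<k}. d dvd p \<longrightarrow> p = d"
  shows "prime p"
proof (rule ccontr)
  assume "\<not> prime p"
  with \<open>1 < p\<close> obtain d where d: "2 \<le> d" "d < p" "d dvd p"
    by (auto simp: prime_nat_iff')
  then obtain e where e: "p = d * e" by (auto simp: dvd_def)
  have "2 \<le> e" "e < p" using d e by (cases "e < 2"; auto simp: less_2_cases_iff)+
  moreover have "\<not> d < k" using no_dvd d by auto
  moreover have "e dvd p" using e by simp
  then have "\<not> e < k" using no_dvd \<open>2 \<le> e\<close> \<open>e < p\<close> by auto
  ultimately have "k * k \<le> p" unfolding e by (intro mult_le_mono) auto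
  with assms show False by simp
qed

text \<open>The ends fit \<open>n = 3\<close> and \<open>n = 9999\<close>: \<open>13 < 15\<close>
  and \<open>42337 > 39996\<close>. Steps by a factor near 5/4 keep the chain short.\<close>

definition prime_chain :: "nat list" where
  "prime_chain = [13, 19, 23, 29, 37, 47, 59, 73, 89, 113, 139, 173, 211, 263, 317, 397, 499, 619,
     773, 967, 1201, 1499, 1873, 2341, 2927, 3659, 4567, 5701, 7129, 8893, 11119, 13883, 17351,
     21683, 27103, 33871, 42337]"

lemma prime_chain_prime: "\<forall>p\<in>set prime_chain. prime p"
proof -
  \<comment> \<open>Over \<open>int\<close>, since the code equations of \<open>nat\<close> compute in unary.\<close>
  have all: "\<forall>p\<in>set (map int prime_chain).
      1 < p \<and> p < 206 * 206 \<and> (\<forall>d\<in>set [2..205]. p mod d \<noteq> 0 \<or> p = d)"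
    unfolding prime_chain_def list.map of_nat_numeral by code_simp
  have *: "1 < int p \<and> int p < 206 * 206 \<and> (\<forall>d\<in>{2..205}. int p mod d \<noteq> 0 \<or> int p = d)"
    if "p \<in> set prime_chain" for p
    by (rule bspec[OF all[unfolded list.set_map set_upto] imageI[OF that]])
  show ?thesis
  proof
    fix p assume "p \<in> set prime_chain"
    note p = *[OF this]
    \<comment> \<open>\<open>206 * 206 = 42436\<close> exceeds the last entry 42337.\<close>
    show "prime p"
    proof (rule prime_nat_trial_division[of _ 206])
      show "1 < p" "p < 206 * 206" using p by linarith+
      show "\<forall>d\<in>{2..<206}. d dvd p \<longrightarrow> p = d"
      proof (intro ballI impI)
        fix d :: nat assume d: "d \<in> {2..<206}" "d dvd p"
        then have "int d \<in> {2..205}" by auto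
        from bspec[OF p[THEN conjunct2, THEN conjunct2] this] d(2) show "p = d"
          by (simp flip: of_nat_mod)
      qed
    qed
  qed
qed

lemma prime_between_4n_5n_small:
  fixes n :: nat
  assumes "n > 2" "n < 10000"
  shows "\<exists>p::nat. prime p \<and> 4 * n < p \<and> p < 5 * n"
proof -
  have "\<exists>p\<in>set prime_chain. 4 * n < p \<and> p < 5 * n"
    unfolding prime_chain_def using assms by (intro exists_in_chain_between_4n_5n) auto
  with prime_chain_prime show ?thesis by blast
qed

theorem theorem2p1p3:
  fixes n :: nat
  assumes "n > 2"
  shows "\<exists>p::nat. prime p \<and> 4 * n < p \<and> p < 5 * n"
  using assms prime_between_4n_5n_small prime_between_4n_5n_large by (cases "n < 10000") auto

end
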